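(* In general, the sets $\mathcal{R}^{r}_{ref}$, $\mathcal{R}^{r}_{MS}$ and $\mathcal{R}^{r}_{AS}$ are not convex: there exists $r\in\mathbb{N}=\{0,1,2,\ldots\}$ such that none of the three sets $\mathcal{R}^{r}_{ref}$, $\mathcal{R}^{r}_{MS}$, $\mathcal{R}^{r}_{AS}$ is convex.
   Context: For $r\in\mathbb{N}$ (with $0\in\mathbb{N}$) and $z\in\mathbb{C}$ define $f_{r,z}\colon\mathbb{R}\to\mathbb{C}$ by $f_{r,z}(t)=\sum_{j=0}^{r+1}\frac{z^j}{j!}+\frac{t^{r+1}}{(r+1)!}z^{r+2}$. Let $\tau_1,\tau_2,\ldots$ be independent random variables, uniformly distributed on $[0,1]$, on a probability space $(\Omega,\Sigma,\mathbb{P})$, and fix $\eta\neq 0$. For $z\in\mathbb{C}$ put $v^r_k=v^r_k(z)=\eta\prod_{l=1}^k f_{r,z}(\tau_l)$, $k\in\mathbb{N}$. Define $\mathcal{R}^r_{MS}=\{z\in\mathbb{C}\colon v^r_k\to0 \text{ in } L^2(\Omega) \text{ as } k\to\infty\}$ (region of mean-square stability), $\mathcal{R}^r_{AS}=\{z\in\mathbb{C}\colon v^r_k\to0 \text{ almost surely as } k\to\infty\}$ (region of asymptotic stability), $\mathcal{R}^r_{ref}=\{z\in\mathbb{C}\colon |\sum_{j=0}^{r+2}\frac{z^j}{j!}|<1\}$ (reference set). Convexity is meant in $\mathbb{C}$ viewed as a real vector space. *)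

theory Defs
  imports "HOL-Probability.Probability"
begin

definition stab_f :: "nat \<Rightarrow> complex \<Rightarrow> real \<Rightarrow> complex" where
  "stab_f r z t =
     (\<Sum>j=0..r + 1. z ^ j / fact j) + complex_of_real (t ^ (r + 1)) / fact (r + 1) * z ^ (r + 2)"

(* The random variables are tau 1, tau 2, ...; the value tau 0 is never used. *)
definition iid_uniform01 :: "'a measure \<Rightarrow> (nat \<Rightarrow> 'a \<Rightarrow> real) \<Rightarrow> bool" where
  "iid_uniform01 M \<tau> \<longleftrightarrow>
     prob_space.indep_vars M (\<lambda>_. borel) \<tau> {1..} \<and>
     (\<forall>l\<ge>1. distr M borel (\<tau> l) = uniform_measure lborel {0..1})"

definition stab_v :: "(nat \<Rightarrow> 'a \<Rightarrow> real) \<Rightarrow> complex \<Rightarrow> nat \<Rightarrow> complex \<Rightarrow> nat \<Rightarrow> 'a \<Rightarrow> complex" where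
  "stab_v \<tau> \<eta> r z k \<omega> = \<eta> * (\<Prod>l=1..k. stab_f r z (\<tau> l \<omega>))"

definition in_L2 :: "'a measure \<Rightarrow> ('a \<Rightarrow> complex) \<Rightarrow> bool" where
  "in_L2 M X \<longleftrightarrow> X \<in> borel_measurable M \<and> integrable M (\<lambda>\<omega>. (cmod (X \<omega>))\<^sup>2)"

definition L2_null :: "'a measure \<Rightarrow> (nat \<Rightarrow> 'a \<Rightarrow> complex) \<Rightarrow> bool" where
  "L2_null M X \<longleftrightarrow>
     (\<forall>k. in_L2 M (X k)) \<and>
     (\<lambda>k. sqrt (LINT \<omega>|M. (cmod (X k \<omega>))\<^sup>2)) \<longlonglongrightarrow> 0"

definition R_MS :: "'a measure \<Rightarrow> (nat \<Rightarrow> 'a \<Rightarrow> real) \<Rightarrow> complex \<Rightarrow> nat \<Rightarrow> complex set" where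
  "R_MS M \<tau> \<eta> r = {z. L2_null M (stab_v \<tau> \<eta> r z)}"

definition R_AS :: "'a measure \<Rightarrow> (nat \<Rightarrow> 'a \<Rightarrow> real) \<Rightarrow> complex \<Rightarrow> nat \<Rightarrow> complex set" where
  "R_AS M \<tau> \<eta> r = {z. AE \<omega> in M. (\<lambda>k. stab_v \<tau> \<eta> r z k \<omega>) \<longlonglongrightarrow> 0}"

definition R_ref :: "nat \<Rightarrow> complex set" where
  "R_ref r = {z. cmod (\<Sum>j=0..r + 2. z ^ j / fact j) < 1}"

end

theory Submission
  imports Defs
begin

text \<open>
  Take \<open>r = 1\<close>. All three sets avoid \<open>0\<close>, where every factor equals \<open>1\<close>, and contain
  \<open>\<i>\<close> and \<open>-\<i>\<close>, whose midpoint is \<open>0\<close>. Indeed the mean-square growth factor at \<open>\<plusminus>\<i>\<close> is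
  \<open>\<integral>\<^sub>0\<^sup>1 1/4 + (1 - t\<^sup>2/2)\<^sup>2 dt = 29/30 < 1\<close>, so \<open>E|v\<^sub>k|\<^sup>2\<close> decays geometrically; as
  \<open>\<Sum>\<^sub>k E|v\<^sub>k|\<^sup>2\<close> is finite, \<open>v\<^sub>k \<rightarrow> 0\<close> also almost surely.
\<close>

lemma stab_f_continuous: "continuous_on A (stab_f r z)"
  unfolding stab_f_def by (intro continuous_intros) (simp_all del: fact_Suc)

lemma stab_f_measurable [measurable]: "stab_f r z \<in> borel_measurable borel"
  by (intro borel_measurable_continuous_onI stab_f_continuous)

text \<open>The interval has Lebesgue measure 1, so normalisation changes nothing and the uniform
  law is \<open>lborel\<close> with the indicator of \<open>{0..1}\<close> as density. This reduces
  expectations under the law of \<open>\<tau> l\<close> to ordinary integrals.\<close>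

lemma has_bochner_integral_uniform01:
  fixes g :: "real \<Rightarrow> real"
  assumes [measurable]: "g \<in> borel_measurable borel"
    and "has_bochner_integral lborel (\<lambda>t. g t * indicator {0..1} t) m"
  shows "has_bochner_integral (uniform_measure lborel {0..1}) g m"
proof -
  have "has_bochner_integral (density lborel (\<lambda>t. ennreal (indicator {0..1} t))) g m"
    using assms(2) by (intro has_bochner_integral_density) (auto simp: mult.commute)
  moreover have "density lborel (\<lambda>t. ennreal (indicator {0..1::real} t)) = uniform_measure lborel {0..1}"
    unfolding uniform_measure_def by (intro density_cong) (auto simp: indicator_def)
  ultimately show ?thesis by simp
qed

lemma not_convex_if_midpoint:
  fixes S :: "complex set"
  assumes "z \<in> S" "- z \<in> S" "0 \<notin> S"
  shows "\<not> convex S"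
proof
  assume "convex S"
  then have "(1/2) *\<^sub>R z + (1/2) *\<^sub>R (- z) \<in> S"
    using assms by (intro convexD) auto
  with assms(3) show False by simp
qed

locale uniform01_sequence = prob_space M for M :: "'a measure" +
  fixes \<tau> :: "nat \<Rightarrow> 'a \<Rightarrow> real"
  assumes iid: "iid_uniform01 M \<tau>"
begin

lemma indep: "indep_vars (\<lambda>_. borel) \<tau> {1..}"
  using iid unfolding iid_uniform01_def by blast

lemma distr_eq: "l \<ge> 1 \<Longrightarrow> distr M borel (\<tau> l) = uniform_measure lborel {0..1}"
  using iid unfolding iid_uniform01_def by blast

lemma \<tau>_measurable: "l \<ge> 1 \<Longrightarrow> \<tau> l \<in> borel_measurable M"
  using indep unfolding indep_vars_def by auto

lemma stab_v_measurable [measurable]: "stab_v \<tau> \<eta> r z k \<in> borel_measurable M"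
proof -
  have "(\<lambda>\<omega>. stab_f r z (\<tau> l \<omega>)) \<in> borel_measurable M" if "l \<in> {1..k}" for l
    using that by (intro measurable_compose[OF \<tau>_measurable stab_f_measurable]) auto
  then show ?thesis
    unfolding stab_v_def[abs_def] by (intro borel_measurable_times borel_measurable_prod) auto
qed

text \<open>The modulus is multiplicative, so the squared modulus of \<open>stab_v\<close> is a
  product of independent, identically distributed factors with mean \<open>m\<close>; independence
  turns the mean of the product into \<open>m ^ k\<close>.\<close>

lemma stab_v_second_moment:
  assumes m: "has_bochner_integral lborel (\<lambda>t. (cmod (stab_f r z t))\<^sup>2 * indicator {0..1} t) m"
  shows "has_bochner_integral M (\<lambda>\<omega>. (cmod (stab_v \<tau> \<eta> r z k \<omega>))\<^sup>2) ((cmod \<eta>)\<^sup>2 * m ^ k)"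
proof -
  define Y where "Y = (\<lambda>l \<omega>. (cmod (stab_f r z (\<tau> l \<omega>)))\<^sup>2)"
  have Y: "has_bochner_integral M (Y l) m" if "l \<ge> 1" for l
  proof -
    \<comment> \<open>Integration is first done under the law of \<open>\<tau> l\<close>, then
      pulled back to \<open>M\<close> by change of variables.\<close>
    have "has_bochner_integral (distr M borel (\<tau> l)) (\<lambda>t. (cmod (stab_f r z t))\<^sup>2) m"
      unfolding distr_eq[OF that] by (rule has_bochner_integral_uniform01[OF _ m]) measurable
    then show ?thesis
      using \<tau>_measurable[OF that]
      by (auto simp: has_bochner_integral_iff Y_def integral_distr integrable_distr_eq)
  qed
  have ind: "indep_vars (\<lambda>_. borel) Y {1..k}"
    unfolding Y_def
    by (rule indep_vars_compose2[OF indep_vars_subset[OF indep], where Y = "\<lambda>_ t. (cmod (stab_f r z t))\<^sup>2"])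
      auto
  have int: "integrable M (Y l)" "expectation (Y l) = m" if "l \<in> {1..k}" for l
    using Y[of l] that by (auto simp: has_bochner_integral_iff)
  have "has_bochner_integral M (\<lambda>\<omega>. \<Prod>l=1..k. Y l \<omega>) (m ^ k)"
    using indep_vars_integrable[OF _ ind int(1)] indep_vars_lebesgue_integral[OF _ ind int(1)]
    by (simp add: has_bochner_integral_iff int(2))
  then have "has_bochner_integral M (\<lambda>\<omega>. (cmod \<eta>)\<^sup>2 * (\<Prod>l=1..k. Y l \<omega>)) ((cmod \<eta>)\<^sup>2 * m ^ k)"
    by (intro has_bochner_integral_mult_right) auto
  moreover have "(cmod (stab_v \<tau> \<eta> r z k \<omega>))\<^sup>2 = (cmod \<eta>)\<^sup>2 * (\<Prod>l=1..k. Y l \<omega>)" for \<omega>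
    by (simp add: stab_v_def Y_def norm_mult power_mult_distrib flip: prod_norm prod_power_distrib)
  ultimately show ?thesis by simp
qed

lemma mean_square_stable:
  assumes m: "has_bochner_integral lborel (\<lambda>t. (cmod (stab_f r z t))\<^sup>2 * indicator {0..1} t) m"
    and "0 \<le> m" "m < 1"
  shows "z \<in> R_MS M \<tau> \<eta> r"
proof -
  note mom = stab_v_second_moment[OF m, of \<eta>, unfolded has_bochner_integral_iff]
  have "(\<lambda>k. m ^ k) \<longlonglongrightarrow> 0"
    using assms by (intro LIMSEQ_realpow_zero) auto
  then have "(\<lambda>k. sqrt ((cmod \<eta>)\<^sup>2 * m ^ k)) \<longlonglongrightarrow> sqrt ((cmod \<eta>)\<^sup>2 * 0)"
    by (intro tendsto_real_sqrt tendsto_mult tendsto_const)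
  then show ?thesis
    using mom by (simp add: R_MS_def L2_null_def in_L2_def)
qed

lemma asymptotically_stable:
  assumes m: "has_bochner_integral lborel (\<lambda>t. (cmod (stab_f r z t))\<^sup>2 * indicator {0..1} t) m"
    and "0 \<le> m" "m < 1"
  shows "z \<in> R_AS M \<tau> \<eta> r"
proof -
  let ?V = "\<lambda>k \<omega>. (cmod (stab_v \<tau> \<eta> r z k \<omega>))\<^sup>2"
  note mom = stab_v_second_moment[OF m, of \<eta>, unfolded has_bochner_integral_iff]
  have "summable (\<lambda>k. (cmod \<eta>)\<^sup>2 * m ^ k)"
    using assms by (intro summable_mult summable_geometric) auto
  then have "(\<Sum>k. ennreal ((cmod \<eta>)\<^sup>2 * m ^ k)) \<noteq> \<infinity>"
    using assms by (simp add: suminf_ennreal2)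
  moreover have "(\<integral>\<^sup>+\<omega>. ennreal (?V k \<omega>) \<partial>M) = ennreal ((cmod \<eta>)\<^sup>2 * m ^ k)" for k
    using mom[of k] by (simp add: nn_integral_eq_integral)
  \<comment> \<open>Monotone convergence swaps sum and integral. A nonnegative function with finite
    integral is finite almost everywhere, and terms of a convergent series tend to 0.\<close>
  ultimately have "(\<integral>\<^sup>+\<omega>. (\<Sum>k. ennreal (?V k \<omega>)) \<partial>M) \<noteq> \<infinity>"
    by (subst nn_integral_suminf) auto
  then have "AE \<omega> in M. (\<Sum>k. ennreal (?V k \<omega>)) \<noteq> \<infinity>"
    by (intro nn_integral_PInf_AE) auto
  then have "AE \<omega> in M. (\<lambda>k. stab_v \<tau> \<eta> r z k \<omega>) \<longlonglongrightarrow> 0"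
  proof eventually_elim
    case (elim \<omega>)
    then have "summable (\<lambda>k. ?V k \<omega>)"
      by (intro summable_suminf_not_top) auto
    then have "(\<lambda>k. sqrt (?V k \<omega>)) \<longlonglongrightarrow> sqrt 0"
      by (intro tendsto_intros summable_LIMSEQ_zero)
    then show ?case
      by (simp add: tendsto_norm_zero_iff)
  qed
  then show ?thesis by (simp add: R_AS_def)
qed

end

lemma stab_f_1:
  "stab_f 1 z t = 1 + z + z\<^sup>2 / 2 + complex_of_real (t\<^sup>2) / 2 * z ^ 3"
  by (simp add: stab_f_def numeral_eq_Suc)

text \<open>Every factor is 1 at the origin, so the sequence never decays; this excludes 0 from both
  stochastic regions.\<close>

lemma stab_v_1_zero: "stab_v \<tau> \<eta> 1 0 k \<omega> = \<eta>"
  unfolding stab_v_def stab_f_1 by simp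

lemma growth_factor_at_ii:
  assumes "z \<in> {\<i>, - \<i>}"
  shows "has_bochner_integral lborel (\<lambda>t. (cmod (stab_f 1 z t))\<^sup>2 * indicator {0..1} t) (29/30)"
proof -
  \<comment> \<open>With z = \<plusminus>\<i> the factor is 1/2 \<plusminus> \<i>(1 - t^2/2), whose
    squared modulus is 1/4 + (1 - t^2/2)^2.\<close>
  have eq: "(cmod (stab_f 1 z t))\<^sup>2 = 5/4 - t\<^sup>2 + t^4/4" for t
    using assms unfolding stab_f_1 cmod_power2
    by (auto simp: power2_eq_square power3_eq_cube power4_eq_xxxx algebra_simps)
  have "has_bochner_integral lborel (\<lambda>t. (5/4 - t\<^sup>2 + t^4/4) * indicator {0..1} t)
      ((5/4 * 1 - 1^3/3 + 1^5/20) - (5/4 * 0 - 0^3/3 + 0^5/20 :: real))"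
    by (rule has_bochner_integral_FTC_Icc_real[where F = "\<lambda>t. 5/4 * t - t^3/3 + t^5/20"])
      (auto intro!: derivative_eq_intros)
  then show ?thesis unfolding eq by simp
qed

theorem mainTheorem7:
  fixes M :: "'a measure" and \<tau> :: "nat \<Rightarrow> 'a \<Rightarrow> real" and \<eta> :: complex
  assumes "prob_space M"
    and "iid_uniform01 M \<tau>"
    and "\<eta> \<noteq> 0"
  shows "\<exists>r::nat. \<not> convex (R_ref r) \<and> \<not> convex (R_MS M \<tau> \<eta> r) \<and> \<not> convex (R_AS M \<tau> \<eta> r)"
proof (intro exI[of _ 1] conjI)
  interpret prob_space M by fact
  interpret uniform01_sequence M \<tau> by unfold_locales fact
  \<comment> \<open>Squaring avoids the root in \<open>cmod\<close>. On the imaginary axis, z =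
    \<i>y, the squared modulus of this cubic is 1 - y^4/12 + y^6/36, which is below 1 for 0 < |y| <
    sqrt 3. For r = 0 it would be 1 + y^4/4, so \<plusminus>\<i> would fail there.\<close>
  have ref: "z \<in> R_ref 1 \<longleftrightarrow> (cmod (1 + z + z\<^sup>2 / 2 + z ^ 3 / 6))\<^sup>2 < 1" for z
    by (simp add: R_ref_def numeral_eq_Suc power_less_one_iff del: power_Suc)
  \<comment> \<open>The squared modulus is 17/18 at \<plusminus>\<i> and 1 at 0.\<close>
  show "\<not> convex (R_ref 1)"
    by (rule not_convex_if_midpoint[of \<i>])
      (auto simp: ref[unfolded cmod_power2] power3_eq_cube power2_eq_square simp del: One_nat_def)
  show "\<not> convex (R_MS M \<tau> \<eta> 1)"
  proof (rule not_convex_if_midpoint[of \<i>])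
    \<comment> \<open>The total mass is 1, so the constant \<open>\<eta>\<close> has norm
      \<open>cmod \<eta>\<close>, which is nonzero.\<close>
    have "sqrt (LINT \<omega>|M. (cmod (stab_v \<tau> \<eta> 1 0 k \<omega>))\<^sup>2) = cmod \<eta>" for k
      by (simp only: stab_v_1_zero) (simp add: prob_space)
    then show "0 \<notin> R_MS M \<tau> \<eta> 1"
      using assms(3) by (simp add: R_MS_def L2_null_def LIMSEQ_const_iff)
  qed (rule mean_square_stable[OF growth_factor_at_ii]; simp)+
  show "\<not> convex (R_AS M \<tau> \<eta> 1)"
  proof (rule not_convex_if_midpoint[of \<i>])
    show "0 \<notin> R_AS M \<tau> \<eta> 1"
      unfolding R_AS_def mem_Collect_eq stab_v_1_zero
      using assms(3) by (simp add: LIMSEQ_const_iff)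
  qed (rule asymptotically_stable[OF growth_factor_at_ii]; simp)+
qed

end
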